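(* Let $\mathcal{A}$ be a nonempty alphabet set (a discrete set, finite or infinite, or a metric space $(\mathcal{A},d)$), let $\Omega=\mathcal{A}^{\mathbb{N}}$ be the full shift space with shift map $\sigma$, and let $\overline{\sigma}$ be the induced map on the hyperspace $\mathcal{K}(\Omega)$ of nonempty compact subsets of $\Omega$. Then $(\mathcal{K}(\Omega),\overline{\sigma})$ is locally eventually onto.
   Context: Sequences in $\mathcal{A}^{\mathbb{N}}$ are indexed from $0$, and $\sigma(x_0x_1x_2\ldots)=x_1x_2x_3\ldots$. The space $\mathcal{A}^{\mathbb{N}}$ carries the metric $D$, where $D(\bar x,\bar y)=\sum_{i=0}^\infty \frac{\delta(x_i,y_i)}{2^i}$ ($\delta$ the discrete metric) if $\mathcal{A}$ is a discrete alphabet, and $D(\bar x,\bar y)=\sum_{i=0}^\infty \frac{1}{2^i}\frac{d(x_i,y_i)}{1+d(x_i,y_i)}$ if $\mathcal{A}$ is a general metric space $(\mathcal{A},d)$; both induce the product topology. $\mathcal{K}(\Omega)$ is the set of nonempty compact subsets of $\Omega$ with the Hausdorff metric $D_H$ induced by $D$, and $\overline{\sigma}(K)=\sigma(K)=\{\sigma(\bar x):\bar x\in K\}$. A continuous map $f:X\to X$ is locally eventually onto if for each nonempty open set $U\subseteq X$ there is a positive integer $k$ with $f^k(U)=X$. *)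

theory Defs
  imports "HOL-Analysis.Analysis"
begin

definition full_shift :: "'a set \<Rightarrow> (nat \<Rightarrow> 'a) set" where
  "full_shift A = (UNIV \<rightarrow> A)"

definition shift_map :: "(nat \<Rightarrow> 'a) \<Rightarrow> nat \<Rightarrow> 'a" where
  "shift_map x = (\<lambda>i. x (Suc i))"

definition seq_dist :: "('a \<Rightarrow> 'a \<Rightarrow> real) \<Rightarrow> (nat \<Rightarrow> 'a) \<Rightarrow> (nat \<Rightarrow> 'a) \<Rightarrow> real" where
  "seq_dist e x y = (\<Sum>i. e (x i) (y i) / 2 ^ i)"

text \<open>The metric \<open>D\<close> on sequences over a discrete alphabet; \<open>discrete_metric.dd\<close> is the
  \<open>0\<close>-\<open>1\<close> metric.\<close>

definition discrete_seq_dist :: "(nat \<Rightarrow> 'a) \<Rightarrow> (nat \<Rightarrow> 'a) \<Rightarrow> real" where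
  "discrete_seq_dist = seq_dist discrete_metric.dd"

text \<open>The metric \<open>D\<close> on sequences over an alphabet with metric \<open>d\<close>.\<close>

definition metric_seq_dist :: "('a \<Rightarrow> 'a \<Rightarrow> real) \<Rightarrow> (nat \<Rightarrow> 'a) \<Rightarrow> (nat \<Rightarrow> 'a) \<Rightarrow> real" where
  "metric_seq_dist d = seq_dist (\<lambda>a b. d a b / (1 + d a b))"

text \<open>The suprema and infima are taken in \<open>real\<close>, so the formula is meaningful for nonempty
  sets on which \<open>D\<close> is bounded; it is applied to nonempty compact sets below. The value \<open>0\<close> when
  one of the sets is empty keeps the function nonnegative everywhere, which the locale
  \<^locale>\<open>Metric_space\<close> demands even outside the carrier.\<close>

definition hausdorff_dist :: "('b \<Rightarrow> 'b \<Rightarrow> real) \<Rightarrow> 'b set \<Rightarrow> 'b set \<Rightarrow> real" where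
  "hausdorff_dist D K L =
     (if K = {} \<or> L = {} then 0
      else max (SUP x\<in>K. INF y\<in>L. D x y) (SUP y\<in>L. INF x\<in>K. D x y))"

definition nonempty_compacts :: "'b set \<Rightarrow> ('b \<Rightarrow> 'b \<Rightarrow> real) \<Rightarrow> 'b set set" where
  "nonempty_compacts M D = {K. K \<noteq> {} \<and> compactin (Metric_space.mtopology M D) K}"

definition hyperspace :: "'b set \<Rightarrow> ('b \<Rightarrow> 'b \<Rightarrow> real) \<Rightarrow> 'b set topology" where
  "hyperspace M D = Metric_space.mtopology (nonempty_compacts M D) (hausdorff_dist D)"

definition locally_eventually_onto :: "'b topology \<Rightarrow> ('b \<Rightarrow> 'b) \<Rightarrow> bool" where
  "locally_eventually_onto X f \<longleftrightarrow>
     continuous_map X X f \<and>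
     (\<forall>U. openin X U \<and> U \<noteq> {} \<longrightarrow> (\<exists>k>0. (f ^^ k) ` U = topspace X))"

end

(* Let D be the metric on the full shift.  Since the distance of the alphabet is bounded by 1, two
   sequences with the same first k entries are at distance at most 2 / 2^k.  Given nonempty compact
   sets K and L, let K' consist of all x_0 ... x_(k-1) y_0 y_1 ... with x in K and y in L.  It is a
   continuous image of K \<times> L, hence compact, it lies within 2 / 2^k of K for the Hausdorff distance,
   and its image under the k-th iterate of the shift is L.  So for large k every ball around K is
   mapped onto the whole hyperspace, with k depending only on the radius.  The shift is Lipschitz
   for D, hence so is the induced map on compact sets. *)

theory Submission
  imports Defs
begin

section \<open>The Hausdorff metric\<close>

text \<open>The bound keeps the real suprema in \<open>hausdorff_dist\<close> over bounded sets, so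
  the estimates need no compactness. It is assumed outside \<open>M\<close> as well, which spares
  many membership hypotheses.\<close>

locale bounded_Metric_space = Metric_space M D for M :: "'b set" and D +
  fixes B :: real
  assumes bounded: "D x y \<le> B"
begin

text \<open>An infimum over a merely nonempty \<open>L\<close> need not be attained; strict bounds
  by every \<open>s > r\<close> trade it for actual points of \<open>L\<close>.\<close>

lemma cSUP_cINF_le_iff:
  assumes "K \<noteq> {}" "L \<noteq> {}"
  shows "(SUP x\<in>K. INF y\<in>L. D x y) \<le> r \<longleftrightarrow> (\<forall>x\<in>K. \<forall>s>r. \<exists>y\<in>L. D x y < s)"
proof -
  have below: "bdd_below (D x ` L)" for x
    by (rule bdd_belowI2[of _ 0]) simp
  have "(INF y\<in>L. D x y) \<le> B" for x
    using assms(2) cINF_lower[OF below] bounded order_trans by blast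
  then have above: "bdd_above ((\<lambda>x. INF y\<in>L. D x y) ` K)"
    by (rule bdd_aboveI2)
  have "(INF y\<in>L. D x y) \<le> r \<longleftrightarrow> (\<forall>s>r. \<exists>y\<in>L. D x y < s)" for x
  proof -
    have "(INF y\<in>L. D x y) \<le> r \<longleftrightarrow> (\<forall>s>r. (INF y\<in>L. D x y) < s)"
      by (auto intro: le_less_trans dense_ge less_imp_le)
    then show ?thesis
      by (simp add: cINF_less_iff[OF assms(2) below])
  qed
  then show ?thesis
    using cSUP_le_iff[OF assms(1) above] by simp
qed

lemma hausdorff_dist_le_iff:
  assumes "K \<noteq> {}" "L \<noteq> {}"
  shows "hausdorff_dist D K L \<le> r \<longleftrightarrow>
    (\<forall>x\<in>K. \<forall>s>r. \<exists>y\<in>L. D x y < s) \<and> (\<forall>y\<in>L. \<forall>s>r. \<exists>x\<in>K. D y x < s)"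
proof -
  have "hausdorff_dist D K L =
      max (SUP x\<in>K. INF y\<in>L. D x y) (SUP y\<in>L. INF x\<in>K. D y x)"
    using assms by (simp add: hausdorff_dist_def commute)
  then show ?thesis
    by (simp add: cSUP_cINF_le_iff assms)
qed

lemma hausdorff_dist_commute: "hausdorff_dist D K L = hausdorff_dist D L K"
  unfolding hausdorff_dist_def by (simp add: max.commute commute)

lemma hausdorff_dist_approx:
  assumes "L \<noteq> {}" "x \<in> K" "hausdorff_dist D K L < s"
  obtains y where "y \<in> L" "D x y < s"
  using hausdorff_dist_le_iff[of K L "hausdorff_dist D K L"] assms by blast

lemma hausdorff_dist_nonneg: "0 \<le> hausdorff_dist D K L"
proof (rule ccontr)
  assume neg: "\<not> 0 \<le> hausdorff_dist D K L"
  \<comment> \<open>The default value 0 rules out empty sets, so a negative distance would yield two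
    points at negative distance.\<close>
  then have "K \<noteq> {}" "L \<noteq> {}"
    by (auto simp: hausdorff_dist_def)
  then obtain x y where "D x y < 0"
    using hausdorff_dist_approx[of L _ K 0] neg by (metis all_not_in_conv not_le)
  then show False
    using nonneg[of x y] by linarith
qed

lemma hausdorff_dist_le:
  assumes "K \<noteq> {}" "L \<noteq> {}"
    and "\<And>x. x \<in> K \<Longrightarrow> \<exists>y\<in>L. D x y \<le> r"
    and "\<And>y. y \<in> L \<Longrightarrow> \<exists>x\<in>K. D y x \<le> r"
  shows "hausdorff_dist D K L \<le> r"
  unfolding hausdorff_dist_le_iff[OF assms(1,2)] using assms(3,4) le_less_trans by blast

lemma hausdorff_dist_triangle:
  assumes sub: "K \<subseteq> M" "L \<subseteq> M" "N \<subseteq> M" and ne: "K \<noteq> {}" "L \<noteq> {}" "N \<noteq> {}"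
  shows "hausdorff_dist D K N \<le> hausdorff_dist D K L + hausdorff_dist D L N"
proof -
  \<comment> \<open>One half of the Hausdorff bound, kept general in \<open>K\<close> and
    \<open>N\<close> so that exchanging them gives the other half.\<close>
  have *: "\<exists>z\<in>N. D x z < s"
    if KN: "K \<subseteq> M" "N \<subseteq> M" "N \<noteq> {}" and "x \<in> K"
      and s: "hausdorff_dist D K L + hausdorff_dist D L N < s" for K N x s
  proof -
    \<comment> \<open>Half of the slack in \<open>s\<close> is spent on the approximation from
      \<open>K\<close> to \<open>L\<close>, half on that from \<open>L\<close> to
      \<open>N\<close>.\<close>
    define t where "t = (s - hausdorff_dist D K L - hausdorff_dist D L N) / 2"
    have "t > 0" and s_eq: "s = (hausdorff_dist D K L + t) + (hausdorff_dist D L N + t)"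
      using s by (simp_all add: t_def field_simps)
    obtain y where y: "y \<in> L" "D x y < hausdorff_dist D K L + t"
      using hausdorff_dist_approx[of L x K] ne \<open>x \<in> K\<close> \<open>t > 0\<close> by (metis less_add_same_cancel1)
    obtain z where z: "z \<in> N" "D y z < hausdorff_dist D L N + t"
      using hausdorff_dist_approx[of N y L] KN y \<open>t > 0\<close> by (metis less_add_same_cancel1)
    have "D x z \<le> D x y + D y z"
      using triangle KN sub(2) \<open>x \<in> K\<close> y z by blast
    then have "D x z < s"
      using y z s_eq by linarith
    then show ?thesis
      using z by blast
  qed
  show ?thesis
    unfolding hausdorff_dist_le_iff[OF ne(1,3)]
    using *[of K N] *[of N K] sub ne hausdorff_dist_commute by (simp add: add.commute)
qed

lemma nonempty_compactsD:
  assumes "K \<in> nonempty_compacts M D"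
  shows "K \<noteq> {}" "K \<subseteq> M" "compactin mtopology K" "closedin mtopology K"
  using assms compactin_subset_topspace compactin_imp_closedin[OF Hausdorff_space_mtopology]
  by (force simp: nonempty_compacts_def)+

text \<open>At distance zero every ball around a point of \<open>K\<close> meets \<open>L\<close>,
  so the point lies in the closure of \<open>L\<close>. Compact sets are closed here, which gives
  definiteness on the hyperspace.\<close>

lemma hausdorff_dist_zero_imp_subset:
  assumes "K \<subseteq> M" "closedin mtopology L" "L \<noteq> {}" "hausdorff_dist D K L = 0"
  shows "K \<subseteq> L"
proof
  fix x assume "x \<in> K"
  then have "x \<in> mtopology closure_of L"
    unfolding metric_closure_of using assms hausdorff_dist_approx[of L x K] closedin_subset[OF assms(2)]
    by (auto simp: subset_iff) metis
  then show "x \<in> L"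
    using assms by (simp add: closure_of_closedin)
qed

lemma Metric_space_hausdorff: "Metric_space (nonempty_compacts M D) (hausdorff_dist D)"
proof
  show "0 \<le> hausdorff_dist D K L" for K L
    by (rule hausdorff_dist_nonneg)
  show "hausdorff_dist D K L = hausdorff_dist D L K" for K L
    by (rule hausdorff_dist_commute)
  fix K L N assume KL: "K \<in> nonempty_compacts M D" "L \<in> nonempty_compacts M D"
  note K = nonempty_compactsD[OF KL(1)] and L = nonempty_compactsD[OF KL(2)]
  have "hausdorff_dist D K K \<le> 0"
    using K by (intro hausdorff_dist_le) (auto intro!: bexI simp: subset_iff)
  then show "hausdorff_dist D K L = 0 \<longleftrightarrow> K = L"
    using hausdorff_dist_zero_imp_subset[of K L] hausdorff_dist_zero_imp_subset[of L K]
      K L hausdorff_dist_commute[of K L] hausdorff_dist_nonneg[of K K] by auto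
  assume "N \<in> nonempty_compacts M D"
  then show "hausdorff_dist D K N \<le> hausdorff_dist D K L + hausdorff_dist D L N"
    using hausdorff_dist_triangle K L nonempty_compactsD by metis
qed

end

lemma (in Metric_space) Lipschitz_imp_continuous_map:
  assumes "Metric_space M' d'" "f ` M \<subseteq> M'" "C > 0"
    and Lip: "\<And>x y. x \<in> M \<Longrightarrow> y \<in> M \<Longrightarrow> d' (f x) (f y) \<le> C * d x y"
  shows "continuous_map mtopology (Metric_space.mtopology M' d') f"
proof -
  have "\<exists>\<delta>>0. \<forall>x. x \<in> M \<and> d a x < \<delta> \<longrightarrow> d' (f a) (f x) < \<epsilon>" if "a \<in> M" "\<epsilon> > 0" for a \<epsilon>
  proof (intro exI[of _ "\<epsilon> / C"] conjI strip)
    show "0 < \<epsilon> / C"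
      using that assms by simp
    fix x assume "x \<in> M \<and> d a x < \<epsilon> / C"
    then show "d' (f a) (f x) < \<epsilon>"
      using Lip[of a x] that \<open>C > 0\<close> by (simp add: field_simps)
  qed
  then show ?thesis
    unfolding metric_continuous_map[OF assms(1)] using assms(2) by blast
qed

section \<open>The metric on the full shift\<close>

text \<open>The tail starts with entry 0 of \<open>y\<close>, not entry \<open>k\<close>, so that
  \<open>k\<close> shifts recover all of \<open>y\<close>.\<close>

definition splice_at :: "nat \<Rightarrow> (nat \<Rightarrow> 'a) \<Rightarrow> (nat \<Rightarrow> 'a) \<Rightarrow> nat \<Rightarrow> 'a" where
  "splice_at k x y = (\<lambda>i. if i < k then x i else y (i - k))"

lemma splice_at_0 [simp]: "splice_at 0 x y = y"
  by (simp add: splice_at_def)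

lemma splice_at_Suc_0 [simp]: "splice_at (Suc k) x y 0 = x 0"
  by (simp add: splice_at_def)

lemma shift_map_splice_at_Suc [simp]: "shift_map (splice_at (Suc k) x y) = splice_at k (shift_map x) y"
  by (auto simp: splice_at_def shift_map_def)

lemma shift_map_funpow_splice_at: "(shift_map ^^ k) (splice_at k x y) = y"
  by (induction k arbitrary: x) (simp_all add: funpow_Suc_right del: funpow.simps)

lemma shift_map_in_full_shift: "x \<in> full_shift A \<Longrightarrow> shift_map x \<in> full_shift A"
  by (auto simp: full_shift_def shift_map_def)

lemma splice_at_in_full_shift:
  "x \<in> full_shift A \<Longrightarrow> y \<in> full_shift A \<Longrightarrow> splice_at k x y \<in> full_shift A"
  by (simp add: full_shift_def splice_at_def Pi_iff)

lemma image_funpow: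
  fixes f :: "'a \<Rightarrow> 'a"
  shows "(image f ^^ k) K = (f ^^ k) ` K"
  by (induction k) auto

text \<open>Covers both cases of the theorem: the 0-1 metric and d/(1+d). The bound 1 makes the
  geometric series a majorant of \<open>seq_dist\<close>.\<close>

locale bounded_alphabet = bounded_Metric_space A e 1 for A :: "'a set" and e
begin

abbreviation "\<Omega> \<equiv> full_shift A"
abbreviation "\<rho> \<equiv> seq_dist e"

lemma summable_seq_dist: "summable (\<lambda>i. e (x i) (y i) / 2 ^ i)"
proof (rule summable_comparison_test')
  show "summable (\<lambda>i. (1 / 2 :: real) ^ i)"
    by (simp add: summable_geometric)
  show "norm (e (x i) (y i) / 2 ^ i) \<le> (1 / 2) ^ i" for i
    using bounded[of "x i" "y i"] by (simp add: power_divide divide_right_mono)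
qed

lemma seq_dist_nonneg: "0 \<le> \<rho> x y"
  unfolding seq_dist_def by (intro suminf_nonneg summable_seq_dist) simp

lemma seq_dist_le_2: "\<rho> x y \<le> 2"
proof -
  have "e (x i) (y i) / 2 ^ i \<le> (1 / 2) ^ i" for i
    using bounded[of "x i" "y i"] by (simp add: power_divide divide_right_mono)
  then have "\<rho> x y \<le> (\<Sum>i. (1 / 2) ^ i)"
    unfolding seq_dist_def by (intro suminf_le summable_seq_dist summable_geometric) simp_all
  then show ?thesis
    by (simp add: suminf_geometric)
qed

lemma seq_dist_eq_0_iff:
  assumes "x \<in> \<Omega>" "y \<in> \<Omega>"
  shows "\<rho> x y = 0 \<longleftrightarrow> x = y"
proof -
  have "\<rho> x y = 0 \<longleftrightarrow> (\<forall>i. e (x i) (y i) = 0)"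
    unfolding seq_dist_def by (subst suminf_eq_zero_iff) (simp_all add: summable_seq_dist)
  also have "\<dots> \<longleftrightarrow> x = y"
    using assms by (auto simp: full_shift_def Pi_iff fun_eq_iff)
  finally show ?thesis .
qed

lemma seq_dist_triangle:
  assumes "x \<in> \<Omega>" "y \<in> \<Omega>" "z \<in> \<Omega>"
  shows "\<rho> x z \<le> \<rho> x y + \<rho> y z"
proof -
  have "e (x i) (z i) / 2 ^ i \<le> e (x i) (y i) / 2 ^ i + e (y i) (z i) / 2 ^ i" for i
    using assms triangle[of "x i" "y i" "z i"]
    by (simp add: full_shift_def Pi_iff add_divide_distrib[symmetric] divide_right_mono)
  then show ?thesis
    unfolding seq_dist_def
    by (subst suminf_add) (intro suminf_le summable_add summable_seq_dist | simp)+
qed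

sublocale seq: bounded_Metric_space \<Omega> \<rho> 2
proof
  show "\<rho> x y = \<rho> y x" for x y
    by (simp add: seq_dist_def commute)
qed (simp_all add: seq_dist_nonneg seq_dist_le_2 seq_dist_eq_0_iff seq_dist_triangle)

sublocale hyp: Metric_space "nonempty_compacts \<Omega> \<rho>" "hausdorff_dist \<rho>"
  by (rule seq.Metric_space_hausdorff)

text \<open>Splitting off the term at index 0 leaves the series of the shifted sequences with halved
  weights. This yields the Lipschitz constant 2 of the shift and drives the inductions on
  splices.\<close>

lemma seq_dist_rec: "\<rho> x y = e (x 0) (y 0) + \<rho> (shift_map x) (shift_map y) / 2"
proof -
  have "\<rho> x y = (\<Sum>i. e (x (Suc i)) (y (Suc i)) / 2 ^ i / 2) + e (x 0) (y 0)"
    using suminf_split_head[OF summable_seq_dist[of x y]]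
    by (simp add: seq_dist_def mult.commute)
  also have "(\<Sum>i. e (x (Suc i)) (y (Suc i)) / 2 ^ i / 2) = \<rho> (shift_map x) (shift_map y) / 2"
    unfolding seq_dist_def shift_map_def
    using suminf_divide[OF summable_seq_dist[of "\<lambda>i. x (Suc i)" "\<lambda>i. y (Suc i)"], of 2]
    by simp
  finally show ?thesis by simp
qed

lemma seq_dist_shift_map: "\<rho> (shift_map x) (shift_map y) \<le> 2 * \<rho> x y"
  using seq_dist_rec[of x y] nonneg[of "x 0" "y 0"] by linarith

text \<open>Each common entry contributes 0 and halves what remains; after \<open>k\<close> entries
  the diameter bound 2 is left.\<close>

lemma seq_dist_splice_at_left:
  "x \<in> \<Omega> \<Longrightarrow> \<rho> x (splice_at k x y) \<le> 2 / 2 ^ k"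
proof (induction k arbitrary: x)
  case 0
  then show ?case by (simp add: seq_dist_le_2)
next
  case (Suc k)
  then have "x 0 \<in> A"
    by (simp add: full_shift_def Pi_iff)
  then show ?case
    using Suc.IH[OF shift_map_in_full_shift[OF Suc.prems]]
    by (simp add: seq_dist_rec[of x])
qed

text \<open>Unrolling the recursion reproduces the first terms of \<open>\<rho> x x'\<close>, while
  the contribution of the tails only shrinks. The bound makes splicing jointly continuous.\<close>

lemma seq_dist_splice_at_le: "\<rho> (splice_at k x y) (splice_at k x' y') \<le> \<rho> x x' + \<rho> y y'"
proof (induction k arbitrary: x x')
  case 0
  then show ?case by (simp add: seq_dist_nonneg)
next
  case (Suc k)
  have "\<rho> (splice_at (Suc k) x y) (splice_at (Suc k) x' y') =
      e (x 0) (x' 0) + \<rho> (splice_at k (shift_map x) y) (splice_at k (shift_map x') y') / 2"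
    by (subst seq_dist_rec) simp
  then show ?case
    using Suc[of "shift_map x" "shift_map x'"] seq_dist_nonneg[of y y'] seq_dist_rec[of x x']
    by linarith
qed

lemma continuous_map_shift_map: "continuous_map seq.mtopology seq.mtopology shift_map"
  by (rule seq.Lipschitz_imp_continuous_map[OF seq.Metric_space_axioms, of _ 2])
    (auto simp: shift_map_in_full_shift seq_dist_shift_map)

lemma continuous_map_splice_at:
  "continuous_map (prod_topology seq.mtopology seq.mtopology) seq.mtopology (\<lambda>(x, y). splice_at k x y)"
proof -
  interpret P: Metric_space12 \<Omega> \<rho> \<Omega> \<rho>
    by unfold_locales
  \<comment> \<open>Each component distance is at most the product distance, so their sum is at most
    twice it.\<close>
  have "\<rho> (splice_at k x y) (splice_at k x' y') \<le> 2 * prod_dist \<rho> \<rho> (x, y) (x', y')" for x y x' y'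
    using seq_dist_splice_at_le[of k x y x' y'] P.component_le_prod_metric[where ?x1.0=x and ?x2.0=x' and ?y1.0=y and ?y2.0=y']
    by linarith
  then show ?thesis
    unfolding P.mtopology_prod_metric[symmetric]
    by (intro P.Prod_metric.Lipschitz_imp_continuous_map[OF seq.Metric_space_axioms, of _ 2])
      (auto simp: splice_at_in_full_shift)
qed

lemma image_shift_map_in_nonempty_compacts:
  "K \<in> nonempty_compacts \<Omega> \<rho> \<Longrightarrow> shift_map ` K \<in> nonempty_compacts \<Omega> \<rho>"
  using image_compactin[OF _ continuous_map_shift_map] by (auto simp: nonempty_compacts_def)

lemma image_splice_at_in_nonempty_compacts:
  assumes "K \<in> nonempty_compacts \<Omega> \<rho>" "L \<in> nonempty_compacts \<Omega> \<rho>"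
  shows "(\<lambda>(x, y). splice_at k x y) ` (K \<times> L) \<in> nonempty_compacts \<Omega> \<rho>"
proof -
  have "compactin (prod_topology seq.mtopology seq.mtopology) (K \<times> L)"
    using assms by (simp add: compactin_Times nonempty_compacts_def)
  then show ?thesis
    using assms image_compactin[OF _ continuous_map_splice_at] by (simp add: nonempty_compacts_def)
qed

section \<open>The induced map on the hyperspace\<close>

lemma hausdorff_dist_image_shift_map:
  assumes "K \<noteq> {}" "L \<noteq> {}"
  shows "hausdorff_dist \<rho> (shift_map ` K) (shift_map ` L) \<le> 2 * hausdorff_dist \<rho> K L"
proof -
  have "\<exists>y\<in>L. \<rho> (shift_map x) (shift_map y) < s"
    if "L \<noteq> {}" "x \<in> K" and s: "2 * hausdorff_dist \<rho> K L < s" for K L x s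
  proof -
    \<comment> \<open>The shift at most doubles distances, so an approximation within
      \<open>s / 2\<close> suffices.\<close>
    have "hausdorff_dist \<rho> K L < s / 2"
      using s by simp
    then obtain y where "y \<in> L" "\<rho> x y < s / 2"
      using seq.hausdorff_dist_approx \<open>L \<noteq> {}\<close> \<open>x \<in> K\<close> by metis
    then show ?thesis
      using seq_dist_shift_map[of x y] by (intro bexI[of _ y]) auto
  qed
  from this[of L _ K] this[of K _ L] show ?thesis
    using assms by (simp add: seq.hausdorff_dist_le_iff seq.hausdorff_dist_commute[of L K])
qed

lemma continuous_map_image_shift_map:
  "continuous_map hyp.mtopology hyp.mtopology (image shift_map)"
  by (rule hyp.Lipschitz_imp_continuous_map[OF hyp.Metric_space_axioms, of _ 2])
    (auto simp: image_shift_map_in_nonempty_compacts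
      intro!: hausdorff_dist_image_shift_map dest: seq.nonempty_compactsD(1))

lemma hausdorff_dist_splice_at:
  assumes "K \<subseteq> \<Omega>" "K \<noteq> {}" "L \<noteq> {}"
  shows "hausdorff_dist \<rho> K ((\<lambda>(x, y). splice_at k x y) ` (K \<times> L)) \<le> 2 / 2 ^ k"
proof (rule seq.hausdorff_dist_le)
  fix x assume "x \<in> K"
  moreover obtain y where "y \<in> L"
    using assms by blast
  ultimately show "\<exists>z\<in>(\<lambda>(x, y). splice_at k x y) ` (K \<times> L). \<rho> x z \<le> 2 / 2 ^ k"
    using assms seq_dist_splice_at_left[of x k y] by force
next
  fix z assume "z \<in> (\<lambda>(x, y). splice_at k x y) ` (K \<times> L)"
  then obtain x y where "x \<in> K" "z = splice_at k x y"
    by auto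
  then show "\<exists>x\<in>K. \<rho> z x \<le> 2 / 2 ^ k"
    using assms seq_dist_splice_at_left[of x k y] by (metis seq.commute subsetD)
qed (use assms in auto)

lemma image_funpow_in_nonempty_compacts:
  "K \<in> nonempty_compacts \<Omega> \<rho> \<Longrightarrow> (image shift_map ^^ k) K \<in> nonempty_compacts \<Omega> \<rho>"
  by (induction k) (simp_all add: image_shift_map_in_nonempty_compacts)

lemma nonempty_compacts_subset_image_funpow_ball:
  assumes K: "K \<in> nonempty_compacts \<Omega> \<rho>" and k: "2 / 2 ^ k < r"
  shows "nonempty_compacts \<Omega> \<rho> \<subseteq> (image shift_map ^^ k) ` hyp.mball K r"
proof
  fix L assume L: "L \<in> nonempty_compacts \<Omega> \<rho>"
  \<comment> \<open>Preimage of \<open>L\<close> near \<open>K\<close>: prefixes of length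
    \<open>k\<close> from \<open>K\<close>, tails from \<open>L\<close>.\<close>
  let ?K' = "(\<lambda>(x, y). splice_at k x y) ` (K \<times> L)"
  note ne = seq.nonempty_compactsD(1,2)[OF K] seq.nonempty_compactsD(1)[OF L]
  have "?K' \<in> hyp.mball K r"
    using K L ne k hausdorff_dist_splice_at[of K L k] by (auto simp: image_splice_at_in_nonempty_compacts)
  \<comment> \<open>As \<open>K\<close> is nonempty, every element of \<open>L\<close> occurs as a
    tail.\<close>
  moreover have "(image shift_map ^^ k) ?K' = L"
    using ne(1) by (force simp: image_funpow image_comp shift_map_funpow_splice_at image_iff)
  ultimately show "L \<in> (image shift_map ^^ k) ` hyp.mball K r"
    by (metis imageI)
qed

lemma locally_eventually_onto_hyperspace:
  "locally_eventually_onto (hyperspace \<Omega> \<rho>) (image shift_map)"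
  unfolding locally_eventually_onto_def hyperspace_def
proof (intro conjI strip continuous_map_image_shift_map)
  fix U assume U: "openin hyp.mtopology U \<and> U \<noteq> {}"
  then obtain K r where "K \<in> U" "r > 0" and ball: "hyp.mball K r \<subseteq> U"
    unfolding hyp.openin_mtopology by blast
  have sub: "U \<subseteq> nonempty_compacts \<Omega> \<rho>"
    using U hyp.openin_mtopology by blast
  obtain k where "(1 / 2) ^ k < r / 2"
    using real_arch_pow_inv[of "r / 2" "1 / 2"] \<open>r > 0\<close> by auto
  then have "2 / 2 ^ k < r"
    by (simp add: power_divide field_simps)
  \<comment> \<open>The number of iterations must be positive, hence the passage to
    \<open>Suc k\<close>.\<close>
  moreover have "2 / 2 ^ Suc k \<le> (2 / 2 ^ k :: real)"
    by (simp add: field_simps)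
  ultimately have k: "2 / 2 ^ Suc k < r"
    by linarith
  let ?F = "image shift_map ^^ Suc k"
  have "nonempty_compacts \<Omega> \<rho> \<subseteq> ?F ` hyp.mball K r"
    using sub \<open>K \<in> U\<close> k by (intro nonempty_compacts_subset_image_funpow_ball) blast
  also have "\<dots> \<subseteq> ?F ` U"
    using ball by (rule image_mono)
  finally have "nonempty_compacts \<Omega> \<rho> \<subseteq> ?F ` U" .
  moreover have "?F ` U \<subseteq> nonempty_compacts \<Omega> \<rho>"
    using sub image_funpow_in_nonempty_compacts by blast
  ultimately have "?F ` U = topspace hyp.mtopology"
    by (metis hyp.topspace_mtopology subset_antisym)
  then show "\<exists>k>0. (image shift_map ^^ k) ` U = topspace hyp.mtopology"
    by blast
qed

end

section \<open>Bounding the metric of the alphabet\<close>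

lemma frac_subadditive:
  fixes a b c :: real
  assumes "0 \<le> a" "0 \<le> b" "0 \<le> c" "c \<le> a + b"
  shows "c / (1 + c) \<le> a / (1 + a) + b / (1 + b)"
proof -
  \<comment> \<open>The function t/(1+t) is increasing for nonnegative t.\<close>
  have "c / (1 + c) \<le> (a + b) / (1 + (a + b))"
    using assms by (simp add: divide_simps algebra_simps)
  also have "\<dots> = a / (1 + (a + b)) + b / (1 + (a + b))"
    by (simp add: add_divide_distrib)
  \<comment> \<open>Dropping \<open>b\<close> from the first denominator and \<open>a\<close> from
    the second enlarges both fractions.\<close>
  also have "\<dots> \<le> a / (1 + a) + b / (1 + b)"
    using assms by (intro add_mono divide_left_mono) auto
  finally show ?thesis .
qed

lemma (in Metric_space) bounded_alphabet_frac:
  "bounded_alphabet M (\<lambda>a b. d a b / (1 + d a b))"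
proof unfold_locales
  show "d a b / (1 + d a b) = d b a / (1 + d b a)" for a b
    by (simp add: commute)
  show "d a b / (1 + d a b) = 0 \<longleftrightarrow> a = b" if "a \<in> M" "b \<in> M" for a b
    using that add_nonneg_eq_0_iff[of 1 "d a b"] by simp
  show "d a c / (1 + d a c) \<le> d a b / (1 + d a b) + d b c / (1 + d b c)"
    if "a \<in> M" "b \<in> M" "c \<in> M" for a b c
    using that by (intro frac_subadditive triangle nonneg)
  show "d a b / (1 + d a b) \<le> 1" for a b
    using add_pos_nonneg[of 1 "d a b"] by (simp add: divide_le_eq)
qed simp

lemma bounded_alphabet_discrete: "bounded_alphabet A discrete_metric.dd"
proof -
  interpret Metric_space A discrete_metric.dd
    by (rule metric_M_dd)
  show ?thesis
    by unfold_locales (simp add: discrete_metric.dd_def)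
qed

theorem proposition3p2:
  fixes A :: "'a set" and d :: "'a \<Rightarrow> 'a \<Rightarrow> real"
  assumes "A \<noteq> {}"
  shows "locally_eventually_onto
           (hyperspace (full_shift A) discrete_seq_dist) (image shift_map) \<and>
         (Metric_space A d \<longrightarrow>
           locally_eventually_onto
             (hyperspace (full_shift A) (metric_seq_dist d)) (image shift_map))"
  unfolding discrete_seq_dist_def metric_seq_dist_def
  using bounded_alphabet.locally_eventually_onto_hyperspace bounded_alphabet_discrete
    Metric_space.bounded_alphabet_frac by blast

end
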